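(* For every integer $n\geq 0$, the polynomial $W_n(t)$ is real-rooted, where $W_0(t)=1$ and $$W_n(t)=\sum_{w\in\{0,1,2\}^n}t^{\operatorname{run}(w)}\qquad(n\geq 1).$$ Moreover, the zeros of $W_n(t)$ and $W_{n+1}(t)$ weakly interlace for every $n\geq 0$.
   Context: A strictly increasing run of a word is a maximal consecutive factor whose letters strictly increase from left to right; $\operatorname{run}(w)$ is the number of strictly increasing runs of $w$. A polynomial is real-rooted if all its complex zeros are real (nonzero constants are real-rooted). The zeros of two real-rooted polynomials $g,f$ with $\deg f=\deg g+1=d+1$ weakly interlace if, listing the zeros with multiplicity as $u_1\geq\cdots\geq u_d$ for $g$ and $v_1\geq\cdots\geq v_{d+1}$ for $f$, one has $v_1\geq u_1\geq v_2\geq\cdots\geq u_d\geq v_{d+1}$ (no condition if $d=0$). Here $\deg W_n=n$. *)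

theory Defs
  imports "HOL-Computational_Algebra.Computational_Algebra"
begin

definition factor :: "'a list \<Rightarrow> nat \<Rightarrow> nat \<Rightarrow> 'a list" where
  "factor w i j = take (j - i) (drop i w)"

(* Runs are counted by occurrence, so a factor is identified by the half-open
   interval [i, j) of positions that it occupies, not by its letters. *)
definition incr_factor :: "'a::linorder list \<Rightarrow> nat \<Rightarrow> nat \<Rightarrow> bool" where
  "incr_factor w i j \<longleftrightarrow> i < j \<and> j \<le> length w \<and> sorted_wrt (<) (factor w i j)"

definition is_run :: "'a::linorder list \<Rightarrow> nat \<Rightarrow> nat \<Rightarrow> bool" where
  "is_run w i j \<longleftrightarrow> incr_factor w i j \<and>
     (\<forall>i' j'. incr_factor w i' j' \<and> i' \<le> i \<and> j \<le> j' \<longrightarrow> i' = i \<and> j' = j)"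

definition run :: "'a::linorder list \<Rightarrow> nat" where
  "run w = card {(i, j). is_run w i j}"

definition words3 :: "nat \<Rightarrow> nat list set" where
  "words3 n = {w. length w = n \<and> set w \<subseteq> {0, 1, 2}}"

definition W :: "nat \<Rightarrow> real poly" where
  "W n = (if n = 0 then 1 else \<Sum>w\<in>words3 n. monom 1 (run w))"

definition complex_poly :: "real poly \<Rightarrow> complex poly" where
  "complex_poly p = map_poly complex_of_real p"

(* The zero polynomial is not real-rooted, since every complex number is a zero of it. *)
definition real_rooted :: "real poly \<Rightarrow> bool" where
  "real_rooted p \<longleftrightarrow> (\<forall>z. poly (complex_poly p) z = 0 \<longrightarrow> z \<in> \<real>)"

definition decreasing_zeros :: "real poly \<Rightarrow> real list \<Rightarrow> bool" where
  "decreasing_zeros p xs \<longleftrightarrow>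
     mset (map complex_of_real xs) = proots (complex_poly p) \<and> sorted_wrt (\<ge>) xs"

(* Indices are shifted by one: u ! i and v ! i are the (i+1)-st largest zeros of g and f. *)
definition weakly_interlace :: "real poly \<Rightarrow> real poly \<Rightarrow> bool" where
  "weakly_interlace g f \<longleftrightarrow>
     real_rooted g \<and> real_rooted f \<and> degree f = degree g + 1 \<and>
     (\<exists>u v. decreasing_zeros g u \<and> decreasing_zeros f v \<and>
       (\<forall>i < degree g. v ! i \<ge> u ! i \<and> u ! i \<ge> v ! (i + 1)))"

end

theory Submission
  imports Defs
begin

text \<open>
  For a letter \<open>k\<close> let \<open>P\<^sub>k\<close> be the sum of \<open>t^run(kw)\<close> over the words \<open>w\<close> of length \<open>n\<close>. Prepending a letter gives
  \<open>(P\<^sub>0, P\<^sub>1, P\<^sub>2) \<mapsto> (t P\<^sub>0 + P\<^sub>1 + P\<^sub>2, t P\<^sub>0 + t P\<^sub>1 + P\<^sub>2, t P\<^sub>0 + t P\<^sub>1 + t P\<^sub>2)\<close>: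
  each new entry is the sum of three consecutive terms of the sequence
  \<open>P\<^sub>1, P\<^sub>2, t P\<^sub>0, t P\<^sub>1, t P\<^sub>2\<close>. For \<open>t\<close> in the open upper half plane this preserves the property
  that the values have arguments \<open>\<alpha>\<^sub>0 \<le> \<alpha>\<^sub>1 \<le> \<alpha>\<^sub>2 \<le> \<alpha>\<^sub>0 + Arg t\<close>. As \<open>P\<^sub>2 = t W\<^sub>n\<close> and
  \<open>P\<^sub>0 + P\<^sub>1 + P\<^sub>2 = W\<^sub>n\<^sub>+\<^sub>1\<close>, it follows that \<open>W\<^sub>n\<close> does not vanish there and that \<open>W\<^sub>n\<^sub>+\<^sub>1/W\<^sub>n\<close> has an
  argument in \<open>[0, pi]\<close>. A ratio of real-rooted polynomials with this property has interlacing
  zeros: approaching a real point \<open>x\<close> vertically, its continuously chosen argument stays in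
  \<open>[0, pi]\<close> and tends to a value determined by the numbers of zeros on both sides of \<open>x\<close>.
\<close>

subsection \<open>Runs and the recurrence\<close>

lemma incr_factor_iff:
  "incr_factor w i j \<longleftrightarrow> i < j \<and> j \<le> length w \<and> (\<forall>k. i \<le> k \<and> Suc k < j \<longrightarrow> w ! k < w ! Suc k)"
proof (cases "i < j \<and> j \<le> length w")
  case True
  then have len: "length (factor w i j) = j - i"
    by (auto simp: factor_def)
  have "sorted_wrt (<) (factor w i j) \<longleftrightarrow>
      (\<forall>m. Suc m < j - i \<longrightarrow> factor w i j ! m < factor w i j ! Suc m)"
    by (simp add: sorted_wrt_iff_nth_Suc_transp len)
  also have "\<dots> \<longleftrightarrow> (\<forall>m. Suc m < j - i \<longrightarrow> w ! (i + m) < w ! Suc (i + m))"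
    using True by (simp add: factor_def)
  also have "\<dots> \<longleftrightarrow> (\<forall>k. i \<le> k \<and> Suc k < j \<longrightarrow> w ! k < w ! Suc k)"
  proof (intro iffI allI impI)
    fix k assume "\<forall>m. Suc m < j - i \<longrightarrow> w ! (i + m) < w ! Suc (i + m)" "i \<le> k \<and> Suc k < j"
    then show "w ! k < w ! Suc k"
      by (auto dest!: spec[of _ "k - i"])
  qed auto
  finally show ?thesis using True by (simp add: incr_factor_def)
qed (auto simp: incr_factor_def)

text \<open>A run is determined by its first position, so runs can be counted by their starts: the
  positions not reached by an ascent from the left.\<close>

definition run_starts :: "'a::linorder list \<Rightarrow> nat set" where
  "run_starts w = {i. i < length w \<and> (i = 0 \<or> w ! i \<le> w ! (i - 1))}"

text \<open>An ascent from \<open>i - 1\<close> to \<open>i\<close> would let the factor grow to the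
  left, against maximality.\<close>

lemma is_run_imp_start:
  assumes "is_run w i j"
  shows "i \<in> run_starts w"
proof -
  have inc: "incr_factor w i j" and
    mx: "\<And>i' j'. incr_factor w i' j' \<Longrightarrow> i' \<le> i \<Longrightarrow> j \<le> j' \<Longrightarrow> i' = i \<and> j' = j"
    using assms unfolding is_run_def by blast+
  have "w ! i \<le> w ! (i - 1)" if "i \<noteq> 0"
  proof (rule ccontr)
    assume "\<not> ?thesis"
    then have lt: "w ! (i - 1) < w ! i" by simp
    have "incr_factor w (i - 1) j"
      unfolding incr_factor_iff
    proof (intro conjI allI impI)
      fix k assume k: "i - 1 \<le> k \<and> Suc k < j"
      show "w ! k < w ! Suc k"
      proof (cases "k = i - 1")
        case True
        then show ?thesis using lt that by simp
      next
        case False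
        then show ?thesis using k inc by (auto simp: incr_factor_iff)
      qed
    qed (use inc in \<open>auto simp: incr_factor_iff\<close>)
    from mx[OF this] that show False by simp
  qed
  with inc show ?thesis by (auto simp: run_starts_def incr_factor_iff)
qed

lemma is_run_unique_end:
  assumes "is_run w i j" "is_run w i j'"
  shows "j = j'"
  using assms unfolding is_run_def by (metis nle_le order_refl)

text \<open>The longest increasing factor beginning at \<open>i\<close> is a run: an increasing
  factor around it that starts earlier would contain the step from \<open>i - 1\<close> to
  \<open>i\<close>, which is no ascent.\<close>

lemma start_imp_is_run:
  assumes "i \<in> run_starts w"
  shows "\<exists>j. is_run w i j"
proof -
  let ?J = "{j. incr_factor w i j}"
  have "Suc i \<in> ?J" and fin: "finite ?J"
    using assms by (auto simp: run_starts_def incr_factor_iff intro: finite_subset[of _ "{..length w}"])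
  then have J: "incr_factor w i (Max ?J)"
    using Max_in[of ?J] by blast
  have "is_run w i (Max ?J)"
    unfolding is_run_def
  proof (intro conjI allI impI)
    fix i' j' assume a: "incr_factor w i' j' \<and> i' \<le> i \<and> Max ?J \<le> j'"
    have "i < j'" using a J by (auto simp: incr_factor_iff)
    show i: "i' = i"
    proof (rule ccontr)
      assume "i' \<noteq> i"
      with a have "i' \<le> i - 1" "i \<noteq> 0" by auto
      moreover have "\<And>k. i' \<le> k \<Longrightarrow> Suc k < j' \<Longrightarrow> w ! k < w ! Suc k"
        using a by (simp add: incr_factor_iff)
      from this[of "i - 1"] calculation \<open>i < j'\<close> have "w ! (i - 1) < w ! i"
        by simp
      with assms \<open>i \<noteq> 0\<close> show False by (auto simp: run_starts_def dest: leD)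
    qed
    show "j' = Max ?J"
      using a i fin by (auto intro!: antisym)
  qed (rule J)
  then show ?thesis ..
qed

lemma run_eq_card_run_starts: "run w = card (run_starts w)"
proof -
  have "bij_betw fst {(i, j). is_run w i j} (run_starts w)"
  proof (rule bij_betw_imageI)
    show "inj_on fst {(i, j). is_run w i j}"
      by (auto simp: inj_on_def dest: is_run_unique_end)
    show "fst ` {(i, j). is_run w i j} = run_starts w"
      using start_imp_is_run by (force dest: is_run_imp_start)
  qed
  then show ?thesis unfolding run_def by (rule bij_betw_same_card)
qed

lemma run_singleton: "run [x] = 1"
proof -
  have "run_starts [x] = {0}" by (auto simp: run_starts_def)
  then show ?thesis by (simp add: run_eq_card_run_starts)
qed

text \<open>Prepending \<open>x\<close> shifts the old starts by one and adds the start 0. If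
  \<open>x < y\<close>, the start at \<open>y\<close> is lost and the two changes cancel.\<close>

lemma run_Cons_Cons: "run (x # y # w) = (if x < y then 0 else 1) + run (y # w)"
proof -
  let ?S = "run_starts (y # w)"
  have fin: "finite ?S" by (simp add: run_starts_def)
  have "run_starts (x # y # w) =
      insert 0 (Suc ` (if x < y then ?S - {0} else ?S))" (is "?L = ?R")
  proof (rule set_eqI)
    fix i
    show "i \<in> ?L \<longleftrightarrow> i \<in> ?R"
    proof (cases i)
      case (Suc k)
      then show ?thesis
        by (cases k; cases "x < y") (simp_all add: run_starts_def image_iff leI leD)
    qed (simp add: run_starts_def)
  qed
  moreover have "Suc (card (?S - {0})) = card ?S"
    using fin by (rule card_Suc_Diff1) (simp add: run_starts_def)
  ultimately show ?thesis
    using fin by (simp add: run_eq_card_run_starts card_image)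
qed

section \<open>Splitting words by their first letter\<close>

lemma words3_0: "words3 0 = {[]}"
  by (auto simp: words3_def)

lemma sum_words3_Suc:
  "(\<Sum>w\<in>words3 (Suc n). f w) = (\<Sum>k\<in>{0,1,2}. \<Sum>w\<in>words3 n. f (k # w))"
proof -
  have "bij_betw (\<lambda>(k, w). k # w) ({0,1,2} \<times> words3 n) (words3 (Suc n))"
    by (intro bij_betwI[where g = "\<lambda>w. (hd w, tl w)"])
      (auto simp: words3_def length_Suc_conv)
  then show ?thesis
    unfolding sum.cartesian_product
    by (simp add: sum.reindex_bij_betw[symmetric] case_prod_unfold)
qed

text \<open>The polynomial \<open>P\<^sub>k\<close> of the overview. The letter \<open>k\<close> is
  not counted in \<open>n\<close>, so the words have length \<open>n + 1\<close>.\<close>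

definition W_from :: "nat \<Rightarrow> nat \<Rightarrow> real poly" where
  "W_from k n = (\<Sum>w\<in>words3 n. monom 1 (run (k # w)))"

lemma W_from_0: "W_from k 0 = [:0, 1:]"
  by (simp add: W_from_def words3_0 run_singleton monom_Suc)

lemma W_from_Suc:
  "W_from k (Suc n) = (\<Sum>j\<in>{0,1,2}. (if k < j then 1 else [:0, 1:]) * W_from j n)"
proof -
  have "W_from k (Suc n) = (\<Sum>j\<in>{0,1,2}. \<Sum>w\<in>words3 n. monom 1 (run (k # j # w)))"
    unfolding W_from_def by (rule sum_words3_Suc)
  also have "\<dots> = (\<Sum>j\<in>{0,1,2}. (if k < j then 1 else [:0, 1:]) * W_from j n)"
    unfolding W_from_def sum_distrib_left
    by (intro sum.cong refl) (auto simp: run_Cons_Cons monom_Suc)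
  finally show ?thesis .
qed

lemma W_Suc: "W (Suc n) = W_from 0 n + W_from 1 n + W_from 2 n"
  by (simp add: W_def sum_words3_Suc W_from_def)

text \<open>No letter exceeds 2, so a leading 2 is always a run of its own. Hence one triple of
  polynomials carries both \<open>W n\<close> and \<open>W (Suc n)\<close>.\<close>

lemma W_from_2: "W_from 2 n = [:0, 1:] * W n"
proof (cases n)
  case 0
  then show ?thesis by (simp add: W_from_0 W_def)
next
  case (Suc m)
  show ?thesis
    unfolding Suc W_from_Suc W_Suc by (simp add: algebra_simps)
qed

text \<open>In the recurrence only terms with a factor t reach the top degree; the term
  \<open>j = 0\<close> always does, and positivity rules out cancellation.\<close>

lemma W_from_leading:
  assumes "k \<le> 2"
  shows "degree (W_from k n) \<le> Suc n \<and> coeff (W_from k n) (Suc n) > 0"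
  using assms
proof (induction n arbitrary: k)
  case 0
  then show ?case by (simp add: W_from_0)
next
  case (Suc n)
  have IH: "degree (W_from 0 n) \<le> Suc n" "coeff (W_from 0 n) (Suc n) > 0"
    "degree (W_from 1 n) \<le> Suc n" "coeff (W_from 1 n) (Suc n) > 0"
    "degree (W_from 2 n) \<le> Suc n" "coeff (W_from 2 n) (Suc n) > 0"
    using Suc.IH by auto
  have z: "coeff (W_from j n) i = 0" if "j \<in> {0,1,2}" "i > Suc n" for i j
    using IH that by (auto intro!: coeff_eq_0)
  have "degree (W_from k (Suc n)) \<le> Suc (Suc n)"
  proof (rule degree_le, intro allI impI)
    fix i assume i: "Suc (Suc n) < i"
    then obtain i' where "i = Suc i'" by (cases i) auto
    with i show "coeff (W_from k (Suc n)) i = 0"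
      by (auto simp: W_from_Suc z)
  qed
  moreover have "k = 0 \<or> k = 1 \<or> k = 2" using Suc.prems by auto
  then have "coeff (W_from k (Suc n)) (Suc (Suc n)) > 0"
    using IH by (auto simp: W_from_Suc z)
  ultimately show ?case ..
qed

lemma degree_W: "degree (W n) = n" and lead_coeff_W_pos: "lead_coeff (W n) > 0"
proof -
  have *: "degree (W n) \<le> n \<and> coeff (W n) n > 0"
  proof (cases n)
    case (Suc m)
    have "degree (W_from k m) \<le> Suc m" "coeff (W_from k m) (Suc m) > 0" if "k \<in> {0,1,2}" for k
      using W_from_leading[of k m] that by auto
    then show ?thesis unfolding Suc W_Suc
      by (auto intro!: degree_add_le add_pos_pos)
  qed (simp add: W_def)
  then show "degree (W n) = n"
    by (metis le_antisym le_degree less_numeral_extra(3))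
  with * show "lead_coeff (W n) > 0" by simp
qed

subsection \<open>Arguments of complex numbers\<close>

text \<open>Rotation by -\<alpha> puts the first summand on the positive real axis, leaving a sum
  \<open>w\<close> whose \<open>Arg\<close> has to lie in \<open>[0, \<delta>]\<close>. The
  arguments are not reduced modulo 2 pi.\<close>

lemma rcis_add_between:
  assumes "r > 0" "s > 0" "\<alpha> \<le> \<beta>" "\<beta> < \<alpha> + pi"
  obtains \<rho> \<gamma> where "\<rho> > 0" "\<alpha> \<le> \<gamma>" "\<gamma> \<le> \<beta>" "rcis r \<alpha> + rcis s \<beta> = rcis \<rho> \<gamma>"
proof -
  define \<delta> where "\<delta> = \<beta> - \<alpha>"
  define w where "w = of_real r + rcis s \<delta>"
  have \<delta>: "0 \<le> \<delta>" "\<delta> < pi" using assms by (auto simp: \<delta>_def)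
  have rot: "rcis r \<alpha> + rcis s \<beta> = cis \<alpha> * w"
    by (simp add: w_def \<delta>_def rcis_def distrib_left cis_mult)
  have Im: "Im w = s * sin \<delta>" and Re: "Re w = r + s * cos \<delta>"
    by (simp_all add: w_def)
  have "w \<noteq> 0"
  proof
    assume "w = 0"
    with Im Re assms have "sin \<delta> = 0" "r + s * cos \<delta> = 0" by auto
    then have "\<delta> = 0" using \<delta> sin_gt_zero[of \<delta>] by force
    with \<open>r + s * cos \<delta> = 0\<close> assms show False by simp
  qed
  have w: "w = rcis (cmod w) (Arg w)" by (simp add: rcis_cmod_Arg)
  have Arg: "- pi < Arg w" "Arg w \<le> pi" using Arg_bounded[of w] by auto
  have sin1: "0 \<le> sin (Arg w)"
  proof -
    have "0 \<le> cmod w * sin (Arg w)"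
      using Im assms \<delta> sin_ge_zero[of \<delta>] by (subst (asm) w) simp
    then show ?thesis using \<open>w \<noteq> 0\<close> by (simp add: zero_le_mult_iff)
  qed
  have "0 \<le> Arg w"
  proof (rule ccontr)
    assume "\<not> ?thesis"
    then have "sin (- Arg w) > 0" using Arg by (intro sin_gt_zero) auto
    with sin1 show False by simp
  qed
  \<comment> \<open>Rotating \<open>w\<close> by -\<delta> gives a nonpositive imaginary part, so
    \<open>Arg w - \<delta>\<close> could only be pi. Then \<delta> = 0 and \<open>w\<close> is
    negative, although its real part is \<open>r + s\<close>.\<close>
  have "Arg w \<le> \<delta>"
  proof (rule ccontr)
    assume "\<not> ?thesis"
    then have lt: "\<delta> < Arg w" by simp
    have "rcis (cmod w) (Arg w) * cis (- \<delta>) = rcis (cmod w) (Arg w - \<delta>)"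
      by (simp add: rcis_def cis_mult)
    then have "cmod w * sin (Arg w - \<delta>) = Im (w * cis (- \<delta>))"
      by (simp add: rcis_cmod_Arg)
    also have "\<dots> = - r * sin \<delta>"
      by (simp add: Im Re algebra_simps)
    also have "\<dots> \<le> 0" using assms \<delta> sin_ge_zero[of \<delta>] by simp
    finally have le: "sin (Arg w - \<delta>) \<le> 0"
      using \<open>w \<noteq> 0\<close> by (simp add: mult_le_0_iff)
    have "Arg w - \<delta> = pi"
      using sin_gt_zero[of "Arg w - \<delta>"] le lt Arg \<delta> by force
    then have \<open>Arg w = pi\<close> "\<delta> = 0" using Arg \<delta> by auto
    then have "w = - of_real (cmod w)" using w by (simp add: rcis_def)
    then have "Re w = - cmod w" by (metis Re_complex_of_real uminus_complex.sel(1))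
    with Re assms \<open>\<delta> = 0\<close> norm_ge_zero[of w] show False by simp
  qed
  show ?thesis
  proof
    show "rcis r \<alpha> + rcis s \<beta> = rcis (cmod w) (\<alpha> + Arg w)"
      unfolding rot by (subst w) (simp add: rcis_def cis_mult)
  qed (use \<open>w \<noteq> 0\<close> \<open>0 \<le> Arg w\<close> \<open>Arg w \<le> \<delta>\<close> in \<open>auto simp: \<delta>_def\<close>)
qed

lemma rcis_eq_imp_arg_eq:
  assumes "rcis r a = rcis s b" "r > 0" "s > 0" "\<bar>a - b\<bar> < 2 * pi"
  shows "a = b"
proof -
  have "r = s" using arg_cong[OF assms(1), of cmod] assms(2,3) by simp
  with assms have "cis a = cis b" by (simp add: rcis_def)
  then have "cos (a - b) = 1"
    by (metis Re_complex_of_real cis.simps(1) cis_divide cis_neq_zero divide_self of_real_1)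
  then obtain k :: int where "a - b = of_int k * 2 * pi"
    by (auto simp: cos_one_2pi_int)
  moreover from this have "\<bar>of_int k :: real\<bar> < 1" using assms(4) by (simp add: abs_mult)
  then have "k = 0" by linarith
  ultimately show ?thesis by simp
qed

text \<open>A relation instead of \<open>Arg\<close>: arguments may leave \<open>(-pi, pi]\<close>,
  so they remain comparable after multiplication by \<open>z\<close>.\<close>

definition has_arg :: "complex \<Rightarrow> real \<Rightarrow> bool" where
  "has_arg a \<alpha> \<longleftrightarrow> (\<exists>r>0. a = rcis r \<alpha>)"

lemma has_arg_add:
  assumes "has_arg a \<alpha>" "has_arg b \<beta>" "\<alpha> \<le> \<beta>" "\<beta> < \<alpha> + pi"
  obtains \<gamma> where "\<alpha> \<le> \<gamma>" "\<gamma> \<le> \<beta>" "has_arg (a + b) \<gamma>"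
  using assms rcis_add_between unfolding has_arg_def by metis

lemma has_arg_unique:
  assumes "has_arg a \<alpha>" "has_arg a \<beta>" "\<bar>\<alpha> - \<beta>\<bar> < 2 * pi"
  shows "\<alpha> = \<beta>"
  using assms rcis_eq_imp_arg_eq unfolding has_arg_def by metis

lemma has_arg_Arg: "Im z > 0 \<Longrightarrow> has_arg z (Arg z)"
  unfolding has_arg_def using rcis_cmod_Arg[of z] by (intro exI[of _ "cmod z"]) auto

lemma has_arg_mult:
  assumes "has_arg a \<alpha>" "has_arg b \<beta>"
  shows "has_arg (a * b) (\<alpha> + \<beta>)"
  using assms unfolding has_arg_def by (metis rcis_mult mult_pos_pos)

section \<open>The sector condition and its preservation\<close>

text \<open>The last bound says that \<open>z * a\<close> does not precede \<open>c\<close>: the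
  arguments of \<open>a, b, c, z * a, z * b, z * c\<close> increase weakly.\<close>

definition in_sector :: "complex \<Rightarrow> complex \<Rightarrow> complex \<Rightarrow> complex \<Rightarrow> bool" where
  "in_sector z a b c \<longleftrightarrow> (\<exists>\<alpha> \<beta> \<gamma>. \<alpha> \<le> \<beta> \<and> \<beta> \<le> \<gamma> \<and> \<gamma> \<le> \<alpha> + Arg z \<and>
     has_arg a \<alpha> \<and> has_arg b \<beta> \<and> has_arg c \<gamma>)"

lemma Arg_upper_half_plane:
  assumes "Im z > 0"
  shows "0 < Arg z" "Arg z < pi"
proof -
  have "cmod z * sin (Arg z) > 0" 
    using assms by (subst (asm) rcis_cmod_Arg[symmetric]) simp
  then have s: "sin (Arg z) > 0" by (simp add: zero_less_mult_iff)
  have b: "- pi < Arg z" "Arg z \<le> pi" using Arg_bounded[of z] by auto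
  show "0 < Arg z"
    using s b sin_ge_zero[of "- Arg z"] by force
  show "Arg z < pi"
    using s b by (cases "Arg z = pi") auto
qed

text \<open>Any three consecutive terms of \<open>b, c, z * a, z * b, z * c\<close> have arguments
  within a range of length at most \<open>Arg z < pi\<close>, so their sum has an argument in that
  range.\<close>

lemma in_sector_step:
  assumes z: "Im z > 0" and "in_sector z a b c"
  shows "in_sector z (z * a + b + c) (z * a + z * b + c) (z * a + z * b + z * c)"
proof -
  define \<theta> where "\<theta> = Arg z"
  have \<theta>: "0 < \<theta>" "\<theta> < pi" using Arg_upper_half_plane[OF z] by (auto simp: \<theta>_def)
  obtain \<alpha> \<beta> \<gamma> where le: "\<alpha> \<le> \<beta>" "\<beta> \<le> \<gamma>" "\<gamma> \<le> \<alpha> + \<theta>"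
    and args: "has_arg a \<alpha>" "has_arg b \<beta>" "has_arg c \<gamma>"
    using assms(2) unfolding in_sector_def \<theta>_def by blast
  have rotate: "has_arg (z * w) (x + \<theta>)" if "has_arg w x" for w x
    using has_arg_mult[OF has_arg_Arg[OF z] that] by (simp add: \<theta>_def add.commute)
  \<comment> \<open>Two neighbouring sums of three terms share a partial sum of two terms, whose argument
    separates theirs; hence each sum is bracketed in two ways.\<close>
  obtain p where p: "\<beta> \<le> p" "p \<le> \<gamma>" "has_arg (b + c) p"
    by (rule has_arg_add[OF args(2,3)]) (use le \<theta> in linarith)+
  obtain q where q: "\<gamma> \<le> q" "q \<le> \<alpha> + \<theta>" "has_arg (c + z * a) q"
    by (rule has_arg_add[OF args(3) rotate[OF args(1)]]) (use le \<theta> in linarith)+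
  obtain r where r: "\<alpha> + \<theta> \<le> r" "r \<le> \<beta> + \<theta>" "has_arg (z * a + z * b) r"
    by (rule has_arg_add[OF rotate[OF args(1)] rotate[OF args(2)]]) (use le \<theta> in linarith)+
  obtain x where x: "\<beta> \<le> x" "x \<le> q" "has_arg (b + (c + z * a)) x"
    by (rule has_arg_add[OF args(2) q(3)]) (use le \<theta> q in linarith)+
  obtain x' where x': "p \<le> x'" "x' \<le> \<alpha> + \<theta>" "has_arg ((b + c) + z * a) x'"
    by (rule has_arg_add[OF p(3) rotate[OF args(1)]]) (use le \<theta> p in linarith)+
  obtain y where y: "q \<le> y" "y \<le> \<beta> + \<theta>" "has_arg ((c + z * a) + z * b) y"
    by (rule has_arg_add[OF q(3) rotate[OF args(2)]]) (use le \<theta> q in linarith)+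
  obtain y' where y': "\<gamma> \<le> y'" "y' \<le> r" "has_arg (c + (z * a + z * b)) y'"
    by (rule has_arg_add[OF args(3) r(3)]) (use le \<theta> r in linarith)+
  obtain w where w: "r \<le> w" "w \<le> \<gamma> + \<theta>" "has_arg ((z * a + z * b) + z * c) w"
    by (rule has_arg_add[OF r(3) rotate[OF args(3)]]) (use le \<theta> r in linarith)+
  obtain w' where w': "\<alpha> + \<theta> \<le> w'" "w' \<le> p + \<theta>" "has_arg (z * a + z * (b + c)) w'"
    by (rule has_arg_add[OF rotate[OF args(1)] rotate[OF p(3)]]) (use le \<theta> p in linarith)+
  \<comment> \<open>Both brackets of a sum lie in one interval of length at most \<theta>, so the
    two arguments agree exactly and not only modulo 2 pi.\<close>
  have "x = x'"
  proof (rule has_arg_unique)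
    show "has_arg (b + (c + z * a)) x'" using x'(3) by (simp add: add_ac)
  qed (use x x' p q le \<theta> in \<open>(simp; fail) | linarith\<close>)+
  moreover have "y = y'"
  proof (rule has_arg_unique)
    show "has_arg ((c + z * a) + z * b) y'" using y'(3) by (simp add: add_ac)
  qed (use y y' q r le \<theta> in \<open>(simp; fail) | linarith\<close>)+
  moreover have "w = w'"
  proof (rule has_arg_unique)
    show "has_arg ((z * a + z * b) + z * c) w'" using w'(3) by (simp add: add_ac distrib_left)
  qed (use w w' p r le \<theta> in \<open>(simp; fail) | linarith\<close>)+
  \<comment> \<open>The separators give \<open>x \<le> q \<le> y \<le> r \<le> w\<close>; for the
    wrap-around, \<open>w - \<theta> \<le> p \<le> x\<close>.\<close>
  ultimately have "x \<le> y" "y \<le> w" "w \<le> x + \<theta>"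
    using x x' y y' w w' by linarith+
  moreover have "has_arg (z * a + b + c) x" "has_arg (z * a + z * b + c) y"
    "has_arg (z * a + z * b + z * c) w"
    using x(3) y(3) w(3) by (simp_all add: add_ac)
  ultimately show ?thesis
    unfolding in_sector_def \<theta>_def[symmetric] by blast
qed

lemma in_sector_Arg:
  assumes "Im z > 0"
  shows "in_sector z z z z"
  unfolding in_sector_def
  using has_arg_Arg[OF assms] Arg_upper_half_plane[OF assms]
  by (intro exI[of _ "Arg z"]) auto

text \<open>The sum has an argument \<open>q\<close> in \<open>[\<alpha>, \<gamma>]\<close> and
  \<open>c\<close> has the argument \<open>\<gamma> - \<theta>\<close>, so the quotient has an
  argument in \<open>[0, \<theta>]\<close>.\<close>

lemma in_sector_ratio:
  assumes z: "Im z > 0" and "in_sector z a b (z * c)"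
  obtains s \<phi> where "s > 0" "0 \<le> \<phi>" "\<phi> \<le> pi" "c \<noteq> 0" "a + b + z * c = rcis s \<phi> * c"
proof -
  define \<theta> where "\<theta> = Arg z"
  have \<theta>: "0 < \<theta>" "\<theta> < pi" using Arg_upper_half_plane[OF z] by (auto simp: \<theta>_def)
  obtain \<alpha> \<beta> \<gamma> where le: "\<alpha> \<le> \<beta>" "\<beta> \<le> \<gamma>" "\<gamma> \<le> \<alpha> + \<theta>"
    and args: "has_arg a \<alpha>" "has_arg b \<beta>" "has_arg (z * c) \<gamma>"
    using assms(2) unfolding in_sector_def \<theta>_def by blast
  obtain p where p: "\<beta> \<le> p" "p \<le> \<gamma>" "has_arg (b + z * c) p"
    by (rule has_arg_add[OF args(2,3)]) (use le \<theta> in linarith)+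
  obtain q where q: "\<alpha> \<le> q" "q \<le> p" "has_arg (a + (b + z * c)) q"
    by (rule has_arg_add[OF args(1) p(3)]) (use le p \<theta> in linarith)+
  obtain r1 r2 where r1: "r1 > 0" "z * c = rcis r1 \<gamma>" and r2: "r2 > 0" "a + b + z * c = rcis r2 q"
    using q(3) args(3) by (auto simp: has_arg_def add.assoc)
  have nz: "z * c \<noteq> 0" using r1 by simp
  have "rcis (cmod z * (r2 / r1)) (\<theta> + (q - \<gamma>)) * c
      = rcis (r2 / r1) (q - \<gamma>) * (rcis (cmod z) (Arg z) * c)"
    by (simp add: \<theta>_def rcis_mult algebra_simps)
  also have "\<dots> = rcis r2 q"
    using r1 by (simp add: rcis_cmod_Arg rcis_mult)
  finally have "a + b + z * c = rcis (cmod z * (r2 / r1)) (\<theta> + (q - \<gamma>)) * c"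
    using r2 by simp
  moreover have "cmod z > 0" using z by auto
  then have "cmod z * (r2 / r1) > 0" using r1(1) r2(1) by simp
  moreover have "0 \<le> \<theta> + (q - \<gamma>)" "\<theta> + (q - \<gamma>) \<le> pi" using le p q \<theta> by linarith+
  moreover have "c \<noteq> 0" using nz by auto
  ultimately show ?thesis using that by blast
qed

subsection \<open>Interlacing zeros\<close>

text \<open>This choice of argument depends continuously on \<open>y\<close>, and its limit for
  \<open>y\<close> tending to 0 depends only on the sign of \<open>x - a\<close>.\<close>

lemma linear_factor_polar:
  fixes x y a :: real
  assumes "y > 0"
  shows "Complex x y - of_real a = rcis (cmod (Complex x y - of_real a)) (pi / 2 - arctan ((x - a) / y))"
proof -
  let ?t = "(x - a) / y"
  have norm: "cmod (Complex x y - of_real a) = y * sqrt (1 + ?t\<^sup>2)"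
  proof -
    have "(x - a)\<^sup>2 + y\<^sup>2 = y\<^sup>2 * (1 + ?t\<^sup>2)"
      using assms by (simp add: power_divide field_simps)
    then show ?thesis
      using assms by (simp add: cmod_def real_sqrt_mult)
  qed
  have "sqrt (1 + ?t\<^sup>2) > 0"
    by (simp add: add_pos_nonneg)
  then have "y * sqrt (1 + ?t\<^sup>2) * sin (arctan ?t) = x - a" "y * sqrt (1 + ?t\<^sup>2) * cos (arctan ?t) = y"
    unfolding sin_arctan cos_arctan using assms by simp_all
  then show ?thesis
    unfolding norm by (intro complex_eqI) (simp_all only: Re_rcis Im_rcis cos_diff sin_diff; simp)+
qed

lemma prod_linear_factors_polar:
  fixes x y :: real
  assumes "y > 0"
  obtains r where "r > 0"
    "(\<Prod>a\<leftarrow>vs. Complex x y - of_real a) = rcis r (\<Sum>a\<leftarrow>vs. pi / 2 - arctan ((x - a) / y))"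
proof -
  have "\<exists>r>0. (\<Prod>a\<leftarrow>vs. Complex x y - of_real a) = rcis r (\<Sum>a\<leftarrow>vs. pi / 2 - arctan ((x - a) / y))"
  proof (induction vs)
    case Nil
    show ?case by (intro exI[of _ 1]) simp
  next
    case (Cons a vs)
    then obtain r where r: "r > 0"
      "(\<Prod>a\<leftarrow>vs. Complex x y - of_real a) = rcis r (\<Sum>a\<leftarrow>vs. pi / 2 - arctan ((x - a) / y))"
      by blast
    have "Im (Complex x y - of_real a) \<noteq> 0" using assms by simp
    then have "cmod (Complex x y - of_real a) > 0" by (metis zero_complex.sel(2) zero_less_norm_iff)
    moreover have "(\<Prod>a\<leftarrow>a # vs. Complex x y - of_real a) =
        rcis (cmod (Complex x y - of_real a) * r) (\<Sum>a\<leftarrow>a # vs. pi / 2 - arctan ((x - a) / y))"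
      using linear_factor_polar[OF assms, of x a] by (simp add: r(2) flip: rcis_mult)
    ultimately show ?case using r(1) by (metis mult_pos_pos)
  qed
  then show ?thesis using that by blast
qed

text \<open>A continuous path leaving \<open>[0, pi]\<close> must pass through values just outside
  it, where the sine is negative.\<close>

lemma stays_in_0_pi:
  fixes \<psi> :: "real \<Rightarrow> real"
  assumes cont: "continuous_on {0..} \<psi>" and "\<psi> 0 \<in> {0..pi}"
    and sin: "\<And>s. s > 0 \<Longrightarrow> sin (\<psi> s) \<ge> 0" and "s \<ge> 0"
  shows "\<psi> s \<in> {0..pi}"
proof (rule ccontr)
  assume out: "\<psi> s \<notin> {0..pi}"
  with assms have "s > 0" by (cases "s = 0") auto
  have cont': "continuous_on {0..s} \<psi>"
    by (rule continuous_on_subset[OF cont]) auto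
  consider "\<psi> s < 0" | "\<psi> s > pi" using out by force
  then show False
  proof cases
    case 1
    \<comment> \<open>The cut-off at \<open>- pi / 2\<close> keeps \<open>c\<close> inside
      \<open>(-pi, 0)\<close>, however far away \<open>\<psi> s\<close> is;
      \<open>3 * pi / 2\<close> does the same above pi.\<close>
    define c where "c = max (\<psi> s) (- pi / 2)"
    have c: "- pi < c" "c < 0" "\<psi> s \<le> c" using 1 pi_gt_zero by (simp_all add: c_def less_max_iff_disj del: pi_gt_zero)
    obtain x where x: "0 \<le> x" "x \<le> s" "\<psi> x = c"
      using IVT2'[of \<psi> s c 0] c assms(2) cont' \<open>s > 0\<close> by auto
    with c assms(2) have "x > 0" by (cases "x = 0") auto
    from sin[OF this] x(3) sin_gt_zero[of "- c"] c show False by simp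
  next
    case 2
    define c where "c = min (\<psi> s) (3 * pi / 2)"
    have c: "pi < c" "c < 2 * pi" "c \<le> \<psi> s" using 2 pi_gt_zero by (simp_all add: c_def min_less_iff_disj del: pi_gt_zero)
    obtain x where x: "0 \<le> x" "x \<le> s" "\<psi> x = c"
      using IVT'[of \<psi> 0 c s] c assms(2) cont' \<open>s > 0\<close> by auto
    with c assms(2) have "x > 0" by (cases "x = 0") auto
    from sin[OF this] x(3) sin_gt_zero[of "c - pi"] c show False by (simp add: sin_diff)
  qed
qed

lemma tendsto_arctan_mult_at_top:
  "((\<lambda>s. arctan (a * s)) \<longlongrightarrow> pi / 2 * sgn a) at_top"
proof -
  consider "a > 0" | "a = 0" | "a < 0" by linarith
  then show ?thesis
  proof cases
    case 1
    have "filterlim (\<lambda>s. a * s) at_top at_top"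
      using 1 by (rule filterlim_tendsto_pos_mult_at_top[OF tendsto_const _ filterlim_ident])
    from filterlim_compose[OF tendsto_arctan_at_top this] 1 show ?thesis by simp
  next
    case 3
    have "filterlim (\<lambda>s. a * s) at_bot at_top"
      using 3 by (rule filterlim_tendsto_neg_mult_at_bot[OF tendsto_const _ filterlim_ident])
    from filterlim_compose[OF tendsto_arctan_at_bot this] 3 show ?thesis by simp
  qed simp
qed

lemma tendsto_sum_list:
  fixes f :: "'a \<Rightarrow> 'b \<Rightarrow> real"
  assumes "\<And>a. (f a \<longlongrightarrow> l a) F"
  shows "((\<lambda>s. \<Sum>a\<leftarrow>vs. f a s) \<longlongrightarrow> (\<Sum>a\<leftarrow>vs. l a)) F"
  by (induction vs) (auto intro!: tendsto_add assms)

text \<open>Here \<open>s\<close> is the reciprocal height above \<open>x\<close>. The angle starts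
  at \<open>pi / 2\<close> for \<open>s = 0\<close>, stays in \<open>[0, pi]\<close>, and tends to
  \<open>pi / 2 * (1 - D)\<close> with \<open>D\<close> the difference of the sign sums.\<close>

lemma sgn_sums_close:
  fixes us vs :: "real list"
  assumes sin: "\<And>s. s > 0 \<Longrightarrow>
      sin (pi / 2 - (\<Sum>a\<leftarrow>vs. arctan ((x - a) * s)) + (\<Sum>a\<leftarrow>us. arctan ((x - a) * s))) \<ge> 0"
  shows "\<bar>(\<Sum>a\<leftarrow>vs. sgn (x - a)) - (\<Sum>a\<leftarrow>us. sgn (x - a))\<bar> \<le> 1"
proof -
  let ?A = "\<lambda>ws s. \<Sum>a\<leftarrow>ws. arctan ((x - a) * s)"
  define \<psi> where "\<psi> s = pi / 2 - ?A vs s + ?A us s" for s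
  have cA: "continuous_on S (?A ws)" for S ws
    by (induction ws) (auto intro!: continuous_intros)
  have zero: "?A ws 0 = 0" for ws by (induction ws) auto
  have bnd: "\<psi> s \<in> {0..pi}" if "s \<ge> 0" for s
  proof (rule stays_in_0_pi[of \<psi>])
    show "continuous_on {0..} \<psi>"
      unfolding \<psi>_def by (intro continuous_intros cA)
  qed (use sin that zero in \<open>auto simp: \<psi>_def\<close>)
  define D where "D = (\<Sum>a\<leftarrow>vs. sgn (x - a)) - (\<Sum>a\<leftarrow>us. sgn (x - a))"
  have "(\<psi> \<longlongrightarrow> pi / 2 - (\<Sum>a\<leftarrow>vs. pi / 2 * sgn (x - a)) + (\<Sum>a\<leftarrow>us. pi / 2 * sgn (x - a))) at_top"
    unfolding \<psi>_def by (intro tendsto_intros tendsto_sum_list tendsto_arctan_mult_at_top)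
  also have "pi / 2 - (\<Sum>a\<leftarrow>vs. pi / 2 * sgn (x - a)) + (\<Sum>a\<leftarrow>us. pi / 2 * sgn (x - a)) = pi / 2 * (1 - D)"
    unfolding D_def sum_list_const_mult by (simp add: algebra_simps)
  finally have lim: "(\<psi> \<longlongrightarrow> pi / 2 * (1 - D)) at_top" .
  have ev: "\<forall>\<^sub>F s in at_top. \<psi> s \<in> {0..pi}"
    using eventually_ge_at_top[of 0] by eventually_elim (rule bnd)
  have "pi / 2 * 0 \<le> pi / 2 * (1 - D)"
    by (rule tendsto_lowerbound[OF lim]) (use ev in \<open>auto elim: eventually_mono\<close>)
  moreover have "pi / 2 * (1 - D) \<le> pi / 2 * 2"
    by (rule tendsto_upperbound[OF lim]) (use ev in \<open>auto elim: eventually_mono\<close>)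
  ultimately have "0 \<le> 1 - D" "1 - D \<le> 2"
    by (simp_all only: mult_le_cancel_left_pos half_gt_zero pi_gt_zero)
  then have "\<bar>D\<bar> \<le> 1" by simp
  then show ?thesis by (simp add: D_def)
qed

section \<open>From sign sums to interlacing\<close>

lemma sum_signs: "(\<Sum>i<n. if i < k then - 1 else (1::real)) = real n - 2 * real (min k n)"
  by (induction n) (auto simp: min_def)

text \<open>In the decreasing list only the first \<open>k\<close> entries can be at least
  \<open>x\<close>; each contributes at least -1, every other entry 1.\<close>

lemma sgn_sum_ge:
  assumes "sorted_wrt (\<ge>) ws" "k \<le> length ws" "k < length ws \<Longrightarrow> ws ! k < x"
  shows "(\<Sum>a\<leftarrow>ws. sgn (x - a)) \<ge> real (length ws) - 2 * real k"
proof -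
  have "real (length ws) - 2 * real k = (\<Sum>i<length ws. if i < k then - 1 else (1::real))"
    using assms(2) by (simp add: sum_signs)
  also have "\<dots> \<le> (\<Sum>i<length ws. sgn (x - ws ! i))"
  proof (rule sum_mono)
    fix i assume i: "i \<in> {..<length ws}"
    have "ws ! i < x" if "\<not> i < k"
      using that assms i sorted_wrt_nth_less[OF assms(1), of k i] by (cases "i = k") auto
    then show "(if i < k then - 1 else (1::real)) \<le> sgn (x - ws ! i)"
      by (auto simp: sgn_if)
  qed
  finally show ?thesis by (simp add: sum_list_sum_nth atLeast0LessThan)
qed

lemma sgn_sum_le:
  assumes "sorted_wrt (\<ge>) ws" "k < length ws" "x < ws ! k"
  shows "(\<Sum>a\<leftarrow>ws. sgn (x - a)) \<le> real (length ws) - 2 * real (Suc k)"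
proof -
  have "(\<Sum>i<length ws. sgn (x - ws ! i)) \<le> (\<Sum>i<length ws. if i < Suc k then - 1 else (1::real))"
  proof (rule sum_mono)
    fix i assume i: "i \<in> {..<length ws}"
    have "x < ws ! i" if "i < Suc k"
      using that assms i sorted_wrt_nth_less[OF assms(1), of i k] by (cases "i = k") auto
    then show "sgn (x - ws ! i) \<le> (if i < Suc k then - 1 else (1::real))"
      by (auto simp: sgn_if)
  qed
  also have "\<dots> = real (length ws) - 2 * real (Suc k)"
    using assms(2) by (simp add: sum_signs)
  finally show ?thesis by (simp add: sum_list_sum_nth atLeast0LessThan)
qed

text \<open>At a point \<open>x\<close> strictly between two entries in the wrong order, the two
  sign sums would differ by at least 3.\<close>

lemma interlace_of_sgn_sums_close:
  fixes us vs :: "real list"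
  assumes sorted: "sorted_wrt (\<ge>) us" "sorted_wrt (\<ge>) vs" and len: "length vs = Suc (length us)"
    and close: "\<And>x. \<bar>(\<Sum>a\<leftarrow>vs. sgn (x - a)) - (\<Sum>a\<leftarrow>us. sgn (x - a))\<bar> \<le> 1"
    and i: "i < length us"
  shows "vs ! i \<ge> us ! i \<and> us ! i \<ge> vs ! Suc i"
proof (intro conjI; rule ccontr)
  assume "\<not> vs ! i \<ge> us ! i"
  then obtain x where "vs ! i < x" "x < us ! i" using dense[of "vs ! i" "us ! i"] by auto
  with sgn_sum_ge[OF sorted(2), of i x] sgn_sum_le[OF sorted(1), of i x] i len close[of x]
  show False by (simp add: abs_le_iff)
next
  assume "\<not> us ! i \<ge> vs ! Suc i"
  then obtain x where "us ! i < x" "x < vs ! Suc i" using dense[of "us ! i" "vs ! Suc i"] by auto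
  with sgn_sum_ge[OF sorted(1), of i x] sgn_sum_le[OF sorted(2), of "Suc i" x] i len close[of x]
  show False by (simp add: abs_le_iff)
qed

text \<open>Coefficients are real, so a zero in the lower half plane has its conjugate as a zero in
  the upper one.\<close>

lemma real_rootedI:
  assumes "\<And>z. Im z > 0 \<Longrightarrow> poly (complex_poly p) z \<noteq> 0"
  shows "real_rooted p"
  unfolding real_rooted_def
proof (intro allI impI)
  fix z assume z: "poly (complex_poly p) z = 0"
  have "poly (complex_poly p) (cnj z) = 0"
    using z by (subst real_poly_cnj_root_iff) (auto simp: complex_poly_def coeff_map_poly)
  with z assms[of z] assms[of "cnj z"] have "Im z = 0" by force
  then show "z \<in> \<real>" by (simp add: complex_is_Real_iff)
qed

lemma degree_complex_poly: "degree (complex_poly p) = degree p"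
  unfolding complex_poly_def by (rule degree_map_poly) simp

lemma real_rooted_decreasing_zeros:
  assumes "real_rooted p" "p \<noteq> 0"
  obtains vs where "decreasing_zeros p vs" "length vs = degree p"
    "\<And>z. poly (complex_poly p) z = of_real (lead_coeff p) * (\<Prod>a\<leftarrow>vs. z - of_real a)"
proof -
  let ?P = "complex_poly p"
  define vs where "vs = rev (sorted_list_of_multiset (image_mset Re (proots ?P)))"
  have "?P \<noteq> 0" using assms(2) by (auto simp: complex_poly_def map_poly_eq_0_iff)
  \<comment> \<open>Taking real parts loses nothing, since every zero is real.\<close>
  have "image_mset complex_of_real (image_mset Re (proots ?P)) = image_mset id (proots ?P)"
    unfolding multiset.map_comp
    using assms(1) \<open>?P \<noteq> 0\<close> by (intro image_mset_cong) (auto simp: real_rooted_def)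
  then have ms: "mset (map complex_of_real vs) = proots ?P"
    by (simp add: vs_def)
  moreover have "sorted_wrt (\<ge>) vs"
    by (simp add: vs_def sorted_wrt_rev)
  ultimately have "decreasing_zeros p vs" by (simp add: decreasing_zeros_def)
  moreover have "length vs = degree p"
    using arg_cong[OF ms, of size] by (simp add: size_proots_complex degree_complex_poly)
  moreover have "poly ?P z = of_real (lead_coeff p) * (\<Prod>a\<leftarrow>vs. z - of_real a)" for z
  proof -
    have "poly ?P z = lead_coeff ?P * (\<Prod>x\<in>#proots ?P. z - x)"
      by (subst complex_poly_decompose_multiset[of ?P, symmetric])
        (simp add: poly_prod_mset)
    also have "lead_coeff ?P = of_real (lead_coeff p)"
      by (simp add: degree_complex_poly) (simp add: complex_poly_def coeff_map_poly)
    also have "(\<Prod>x\<in>#proots ?P. z - x) = (\<Prod>a\<leftarrow>vs. z - of_real a)"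
      unfolding ms[symmetric] by (simp add: image_mset.compositionality comp_def flip: prod_mset_prod_list)
    finally show ?thesis .
  qed
  ultimately show ?thesis by (rule that)
qed

lemma sum_list_half_pi_diff:
  "(\<Sum>a\<leftarrow>vs. pi / 2 - f a) = real (length vs) * pi / 2 - (\<Sum>a\<leftarrow>vs. f a)"
  by (induction vs) (auto simp: algebra_simps add_divide_distrib)

text \<open>On the vertical line through \<open>x\<close>, the arguments of \<open>f\<close> and
  \<open>g\<close> are sums over their zeros; the positive leading coefficients add nothing to
  them.\<close>

lemma weakly_interlaceI:
  assumes "degree f = degree g + 1" "lead_coeff f > 0" "lead_coeff g > 0"
    and ratio: "\<And>z. Im z > 0 \<Longrightarrow> \<exists>s \<phi>. s > 0 \<and> 0 \<le> \<phi> \<and> \<phi> \<le> pi \<and> poly (complex_poly g) z \<noteq> 0 \<and>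
      poly (complex_poly f) z = rcis s \<phi> * poly (complex_poly g) z"
  shows "weakly_interlace g f"
proof -
  have rr: "real_rooted f" "real_rooted g"
    using ratio by (force intro!: real_rootedI)+
  have nz: "f \<noteq> 0" "g \<noteq> 0" using assms by auto
  obtain vs where vs: "decreasing_zeros f vs" "length vs = degree f"
    "\<And>z. poly (complex_poly f) z = of_real (lead_coeff f) * (\<Prod>a\<leftarrow>vs. z - of_real a)"
    using real_rooted_decreasing_zeros[OF rr(1) nz(1)] by blast
  obtain us where us: "decreasing_zeros g us" "length us = degree g"
    "\<And>z. poly (complex_poly g) z = of_real (lead_coeff g) * (\<Prod>a\<leftarrow>us. z - of_real a)"
    using real_rooted_decreasing_zeros[OF rr(2) nz(2)] by blast
  have "\<bar>(\<Sum>a\<leftarrow>vs. sgn (x - a)) - (\<Sum>a\<leftarrow>us. sgn (x - a))\<bar> \<le> 1" for x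
  proof (rule sgn_sums_close)
    fix s :: real assume s: "s > 0"
    let ?z = "Complex x (1 / s)"
    define \<Phi> where "\<Phi> ws = (\<Sum>a\<leftarrow>ws. pi / 2 - arctan ((x - a) / (1 / s)))" for ws
    obtain r1 where r1: "r1 > 0" "(\<Prod>a\<leftarrow>vs. ?z - of_real a) = rcis r1 (\<Phi> vs)"
      using prod_linear_factors_polar[of "1 / s" x vs] s unfolding \<Phi>_def by auto
    obtain r2 where r2: "r2 > 0" "(\<Prod>a\<leftarrow>us. ?z - of_real a) = rcis r2 (\<Phi> us)"
      using prod_linear_factors_polar[of "1 / s" x us] s unfolding \<Phi>_def by auto
    obtain t \<phi> where t: "t > 0" "0 \<le> \<phi>" "\<phi> \<le> pi"
      "poly (complex_poly f) ?z = rcis t \<phi> * poly (complex_poly g) ?z"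
      using ratio[of ?z] s by auto
    have "rcis (lead_coeff f * r1) (\<Phi> vs) = rcis (t * (lead_coeff g * r2)) (\<phi> + \<Phi> us)"
      using t(4) unfolding vs(3) us(3) r1(2) r2(2)
      by (simp add: rcis_def cis_mult[symmetric] mult_ac)
    then have "rcis (lead_coeff f * r1) (\<Phi> vs) * cis (- \<Phi> us) =
        rcis (t * (lead_coeff g * r2)) (\<phi> + \<Phi> us) * cis (- \<Phi> us)"
      by simp
    then have "rcis (lead_coeff f * r1) (\<Phi> vs - \<Phi> us) = rcis (t * (lead_coeff g * r2)) \<phi>"
      by (simp add: cis_rcis_eq rcis_mult)
    \<comment> \<open>The angles agree only modulo 2 pi, so just the sign of the sine is kept;
      continuity in \<open>s\<close> later recovers the range.\<close>
    from arg_cong[OF this, of Im]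
    have "lead_coeff f * r1 * sin (\<Phi> vs - \<Phi> us) = t * (lead_coeff g * r2) * sin \<phi>"
      by simp
    also have "\<dots> \<ge> 0" using t r2 assms(3) sin_ge_zero[of \<phi>] by simp
    finally have "sin (\<Phi> vs - \<Phi> us) \<ge> 0"
      using mult_pos_pos[OF assms(2) r1(1)] by (metis zero_le_mult_iff not_le)
    \<comment> \<open>The one extra zero of \<open>f\<close> leaves a single
      \<open>pi / 2\<close>.\<close>
    also have "\<Phi> vs - \<Phi> us =
        pi / 2 - (\<Sum>a\<leftarrow>vs. arctan ((x - a) * s)) + (\<Sum>a\<leftarrow>us. arctan ((x - a) * s))"
      unfolding \<Phi>_def sum_list_half_pi_diff using vs(2) us(2) assms(1) by (simp add: field_simps)
    finally show "0 \<le> sin (pi / 2 - (\<Sum>a\<leftarrow>vs. arctan ((x - a) * s)) + (\<Sum>a\<leftarrow>us. arctan ((x - a) * s)))" .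
  qed
  with interlace_of_sgn_sums_close[of us vs] us vs assms(1)
  have "\<forall>i < degree g. vs ! i \<ge> us ! i \<and> us ! i \<ge> vs ! (i + 1)"
    by (auto simp: decreasing_zeros_def)
  with rr us vs assms(1) show ?thesis
    unfolding weakly_interlace_def by blast
qed

subsection \<open>Real-rootedness and interlacing of the run polynomials\<close>

lemma complex_poly_simps:
  "complex_poly (p + q) = complex_poly p + complex_poly q"
  "complex_poly (pCons a p) = pCons (of_real a) (complex_poly p)"
  "complex_poly 0 = 0"
  by (auto simp: complex_poly_def map_poly_pCons poly_eq_iff coeff_map_poly)

text \<open>At \<open>n = 0\<close> all three values equal \<open>z\<close>; the recurrence is then
  exactly the step that preserves the sector condition.\<close>

lemma in_sector_W_from:
  assumes "Im z > 0"
  shows "in_sector z (poly (complex_poly (W_from 0 n)) z)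
    (poly (complex_poly (W_from 1 n)) z) (poly (complex_poly (W_from 2 n)) z)"
proof (induction n)
  case 0
  have "poly (complex_poly (W_from k 0)) z = z" for k
    by (simp add: W_from_0 complex_poly_def map_poly_pCons)
  then show ?case using in_sector_Arg[OF assms] by simp
next
  case (Suc n)
  show ?case
    using in_sector_step[OF assms Suc.IH]
    by (simp add: W_from_Suc complex_poly_simps distrib_left add.assoc)
qed

theorem theorem6p1:
  shows "(\<forall>n. real_rooted (W n)) \<and> (\<forall>n. weakly_interlace (W n) (W (n + 1)))"
proof -
  have "weakly_interlace (W n) (W (n + 1))" for n
  proof (rule weakly_interlaceI)
    fix z :: complex assume z: "Im z > 0"
    let ?P = "\<lambda>p. poly (complex_poly p) z"
    have "in_sector z (?P (W_from 0 n)) (?P (W_from 1 n)) (z * ?P (W n))"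
      using in_sector_W_from[OF z, of n] by (simp add: W_from_2 complex_poly_simps)
    moreover have "?P (W (n + 1)) = ?P (W_from 0 n) + ?P (W_from 1 n) + z * ?P (W n)"
      by (simp add: W_Suc W_from_2 complex_poly_simps)
    ultimately show "\<exists>s \<phi>. s > 0 \<and> 0 \<le> \<phi> \<and> \<phi> \<le> pi \<and> ?P (W n) \<noteq> 0 \<and>
        ?P (W (n + 1)) = rcis s \<phi> * ?P (W n)"
      using in_sector_ratio[OF z] by metis
  qed (simp_all add: degree_W lead_coeff_W_pos[unfolded degree_W])
  \<comment> \<open>Real-rootedness of both polynomials is part of
    \<open>weakly_interlace\<close>.\<close>
  then show ?thesis by (auto simp: weakly_interlace_def)
qed

end
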